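(* Let $F$ be a bipartite graph on $t$ vertices which is not a star. Then $$\lim_{r\to\infty}\pi_{rt}(rF)=\frac{3-\sqrt5}{2}.$$
   Context: A star on $t$ vertices is the graph $K_{1,t-1}$. An $m$-partite graph $G$ is a graph with a vertex partition $V = V_1\sqcup\dots\sqcup V_m$ into parts such that no edge has both ends in the same part. For disjoint vertex sets $X,Y$, the edge density is $d(X,Y) = \frac{e(X,Y)}{|X||Y|}$, where $e(X,Y)$ is the number of edges between $X$ and $Y$. The $m$-partite density of $G$ is $d_m(G) = \min_{1\le i<j\le m} d(V_i,V_j)$. A traversal of $G$ is a subgraph (on $m$ vertices) containing exactly one vertex from each part. For a graph $F'$ on $m$ vertices, $G$ contains an $F'$-traversal if some traversal of $G$ contains a copy of $F'$ as a subgraph. The critical density is $$\pi_m(F') = \sup\{\alpha\in[0,1] : \text{there exists an } m\text{-partite graph } G \text{ with } d_m(G)\ge\alpha \text{ and no } F'\text{-traversal}\}.$$ $rF$ denotes the graph consisting of $r$ vertex-disjoint copies of $F$.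
   Formalization: "Not a star" is read componentwise: no connected component of F is a star (a single vertex and a single edge count as stars). Without this the claim fails, e.g. for F = 2K_2, where the critical density of rF is 0 for all r. *)

theory Defs
  imports Complex_Main
begin

type_synonym 'a graph = "'a set \<times> 'a set set"

abbreviation verts :: "'a graph \<Rightarrow> 'a set" where "verts G \<equiv> fst G"
abbreviation edges :: "'a graph \<Rightarrow> 'a set set" where "edges G \<equiv> snd G"

definition simple_graph :: "'a graph \<Rightarrow> bool" where
  "simple_graph G \<longleftrightarrow> finite (verts G) \<and>
     edges G \<subseteq> {{u, v} | u v. u \<in> verts G \<and> v \<in> verts G \<and> u \<noteq> v}"

definition subgraph :: "'a graph \<Rightarrow> 'a graph \<Rightarrow> bool" where
  "subgraph H G \<longleftrightarrow> simple_graph H \<and> verts H \<subseteq> verts G \<and> edges H \<subseteq> edges G"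

definition bipartite :: "'a graph \<Rightarrow> bool" where
  "bipartite G \<longleftrightarrow> (\<exists>X Y. X \<union> Y = verts G \<and> X \<inter> Y = {} \<and>
     edges G \<subseteq> {{x, y} | x y. x \<in> X \<and> y \<in> Y})"

text \<open>A star on t vertices is the complete bipartite graph with sides of sizes 1 and t - 1;
  in particular, a single vertex and a single edge are stars.\<close>

definition star :: "'a graph \<Rightarrow> bool" where
  "star G \<longleftrightarrow> (\<exists>c \<in> verts G. edges G = {{c, v} | v. v \<in> verts G - {c}})"

definition component :: "'a graph \<Rightarrow> 'a \<Rightarrow> 'a graph" where
  "component G v =
     (let C = {w. (v, w) \<in> {(x, y). {x, y} \<in> edges G}\<^sup>*} in (C, {e \<in> edges G. e \<subseteq> C}))"

text \<open>For connected graphs with at least one vertex this just says that the graph is not a star.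
  For disconnected F, "not a star" has to be read componentwise in results on r F: if F is 2 K_2,
  say, then r F is a perfect matching on the parts, which exists as a traversal as soon as all
  densities are positive, so the critical density of r F is 0 for every r.\<close>

definition no_star_component :: "'a graph \<Rightarrow> bool" where
  "no_star_component G \<longleftrightarrow> (\<forall>v \<in> verts G. \<not> star (component G v))"

definition copies :: "nat \<Rightarrow> 'a graph \<Rightarrow> (nat \<times> 'a) graph" where
  "copies r F = ({..<r} \<times> verts F, {Pair i ` e | i e. i < r \<and> e \<in> edges F})"

definition contains_copy :: "'a graph \<Rightarrow> 'b graph \<Rightarrow> bool" where
  "contains_copy H F \<longleftrightarrow> (\<exists>f. inj_on f (verts F) \<and> f ` verts F \<subseteq> verts H \<and>
     (\<forall>e \<in> edges F. f ` e \<in> edges H))"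

text \<open>The parts are P 0, ..., P (m - 1). They are required to be nonempty, so that all edge
  densities between them are well defined.\<close>

definition multipartite :: "nat \<Rightarrow> (nat \<Rightarrow> 'a set) \<Rightarrow> 'a graph \<Rightarrow> bool" where
  "multipartite m P G \<longleftrightarrow> simple_graph G \<and> (\<Union>i<m. P i) = verts G \<and>
     (\<forall>i<m. P i \<noteq> {}) \<and> (\<forall>i<m. \<forall>j<m. i \<noteq> j \<longrightarrow> P i \<inter> P j = {}) \<and>
     (\<forall>i<m. \<forall>e \<in> edges G. \<not> e \<subseteq> P i)"

definition edge_density :: "'a graph \<Rightarrow> 'a set \<Rightarrow> 'a set \<Rightarrow> real" where
  "edge_density G X Y =
     real (card {e \<in> edges G. \<exists>x \<in> X. \<exists>y \<in> Y. e = {x, y}}) / (real (card X) * real (card Y))"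

text \<open>Meaningful for m at least 2 only, since otherwise there are no pairs of parts.\<close>

definition partite_density :: "nat \<Rightarrow> (nat \<Rightarrow> 'a set) \<Rightarrow> 'a graph \<Rightarrow> real" where
  "partite_density m P G = Min {edge_density G (P i) (P j) | i j. i < j \<and> j < m}"

definition traversal :: "nat \<Rightarrow> (nat \<Rightarrow> 'a set) \<Rightarrow> 'a graph \<Rightarrow> 'a graph \<Rightarrow> bool" where
  "traversal m P G H \<longleftrightarrow> subgraph H G \<and> (\<forall>i<m. \<exists>!v. v \<in> verts H \<inter> P i)"

definition has_traversal :: "nat \<Rightarrow> (nat \<Rightarrow> 'a set) \<Rightarrow> 'a graph \<Rightarrow> 'b graph \<Rightarrow> bool" where
  "has_traversal m P G F \<longleftrightarrow> (\<exists>H. traversal m P G H \<and> contains_copy H F)"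

text \<open>Every finite graph has an isomorphic copy on natural numbers, so there is no loss of
  generality in letting G range over graphs with vertices of type nat. The set below contains 0
  whenever m is at least 2 and F has an edge (take G edgeless), so the supremum is then a genuine
  one.\<close>

definition critical_density :: "nat \<Rightarrow> 'b graph \<Rightarrow> real" where
  "critical_density m F = Sup {\<alpha> \<in> {0..1}. \<exists>(P :: nat \<Rightarrow> nat set) G.
     multipartite m P G \<and> partite_density m P G \<ge> \<alpha> \<and> \<not> has_traversal m P G F}"

end

theory Submission
  imports Defs "HOL-Library.Ramsey" "HOL-Library.Disjoint_Sets"
begin

text \<open>The limit x is the root in (0,1) of x = (1 - x)^2. For the lower bound, let V_0 = {c}, split
  every other part into A_j and B_j with A_j of proportion close to x, and take all edges between
  c and the A_j and between B_j and B_k. No path of length two starts at c, whereas in a graph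
  without star components one starts at every vertex.

  For the upper bound, let all densities be at least some \<gamma> > x, so that (1 - \<gamma>)^2 < \<gamma>. Given a
  part V_i and many other parts V_j, some v in V_i has neighbourhoods A_j of average proportion at
  least \<gamma> in the V_j. Pairs outside the A_j account for density at most (1 - \<gamma>)^2 on average, so a
  positive density of edges meets the A_j, and averaging over the choices of one vertex per part
  yields a large complete bipartite graph with one side in the neighbourhood of v. Hence V_i together
  with t - 1 of any sufficiently large constant number of other parts hosts a copy of F. By Ramsey's
  theorem for t-uniform hypergraphs, some large constant number of parts forms a reservoir all of
  whose t-subsets host a copy of F. Tile the rest greedily, absorb the bounded leftover into the
  reservoir, and cut what remains of the reservoir into arbitrary t-sets.\<close>

section \<open>Tilings by good sets\<close>

text \<open>Adding one tile at a time suits the greedy and absorption arguments; an indexed family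
  of tiles is recovered by \<open>tiled_enumerate\<close>.\<close>

inductive tiled :: "('a set \<Rightarrow> bool) \<Rightarrow> 'a set \<Rightarrow> bool" for good where
  empty: "tiled good {}"
| insert_tile: "good T \<Longrightarrow> tiled good U \<Longrightarrow> T \<inter> U = {} \<Longrightarrow> tiled good (T \<union> U)"

lemma tiled_Un: "tiled good U \<Longrightarrow> tiled good U' \<Longrightarrow> U \<inter> U' = {} \<Longrightarrow> tiled good (U \<union> U')"
proof (induction rule: tiled.induct)
  case (insert_tile T U)
  then show ?case
    by (metis Int_Un_distrib Int_Un_distrib2 Un_assoc Un_empty tiled.insert_tile)
qed simp

text \<open>Supplies both the divisibility by \<open>t\<close> of the size of a tiled set and the
  list of tiles from which the disjoint copies of F are built.\<close>

lemma tiled_enumerate: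
  assumes "tiled good U" and "\<And>T. good T \<Longrightarrow> finite T \<and> card T = t"
  shows "finite U \<and> (\<exists>r Q. card U = r * t \<and> (\<forall>k<r. good (Q k)) \<and> disjoint_family_on Q {..<r} \<and>
    (\<Union>k<r. Q k) = U)"
  using assms(1)
proof (induction rule: tiled.induct)
  case empty
  show ?case by (auto simp: disjoint_family_on_def intro!: exI[of _ "0::nat"])
next
  case (insert_tile T U)
  then have "finite U" by simp
  from insert_tile obtain r Q where Q: "card U = r * t" "\<forall>k<r. good (Q k)" "disjoint_family_on Q {..<r}"
    "(\<Union>k<r. Q k) = U" by auto
  have T: "finite T" "card T = t" using assms(2) insert_tile by auto
  define Q' where "Q' = Q(r := T)"
  have "card (T \<union> U) = Suc r * t"
    using T Q \<open>finite U\<close> insert_tile by (simp add: card_Un_disjoint)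
  moreover have "\<forall>k<Suc r. good (Q' k)"
    using Q insert_tile by (simp add: Q'_def less_Suc_eq)
  moreover have "(\<Union>k<Suc r. Q' k) = T \<union> U"
    using Q(4) by (auto simp: Q'_def less_Suc_eq split: if_splits)
  moreover have "disjoint_family_on Q' {..<Suc r}"
  proof -
    have "T \<inter> Q n = {}" "Q n \<inter> T = {}" if "n < r" for n
      using that Q(4) \<open>T \<inter> U = {}\<close> by auto
    then show ?thesis
      using Q(3) unfolding disjoint_family_on_def Q'_def by (metis fun_upd_apply lessThan_iff less_SucE)
  qed
  ultimately show ?case
    using T \<open>finite U\<close> by (intro conjI exI[of _ "Suc r"] exI[of _ Q']) simp_all
qed

section \<open>Greedy tiling, absorption and the reservoir\<close>

lemma tiled_if_all_good:
  assumes "finite W" "t dvd card W" "t > 0" "\<And>T. T \<subseteq> W \<Longrightarrow> card T = t \<Longrightarrow> good T"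
  shows "tiled good W"
  using assms
proof (induction "card W" arbitrary: W rule: less_induct)
  case less
  show ?case
  proof (cases "W = {}")
    case False
    then have "t \<le> card W"
      using less.prems by (simp add: dvd_imp_le card_gt_0_iff)
    then obtain T where T: "T \<subseteq> W" "card T = t"
      by (meson obtain_subset_with_card_n)
    have "finite T" using T less.prems(1) finite_subset by blast
    then have c: "card (W - T) = card W - t" using T by (simp add: card_Diff_subset)
    then have "card (W - T) < card W" using \<open>t > 0\<close> \<open>t \<le> card W\<close> by linarith
    moreover have "t dvd card (W - T)" using c less.prems(2) by simp
    ultimately have "tiled good (W - T)"
      using less by (meson Diff_subset finite_Diff order_trans)
    then have "tiled good (T \<union> (W - T))"
      using T less.prems(4) by (intro tiled.insert_tile) auto
    then show ?thesis using T by (simp add: Un_absorb1)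
  qed (simp add: tiled.empty)
qed

text \<open>While more than \<open>M\<close> elements remain, each of them still sees at least
  \<open>M\<close> others, so a further tile can be removed.\<close>

lemma greedy_tiling:
  assumes "finite R" "t > 0"
    and "\<And>i J. i \<in> R \<Longrightarrow> J \<subseteq> R \<Longrightarrow> i \<notin> J \<Longrightarrow> M \<le> card J \<Longrightarrow>
      \<exists>T\<subseteq>J. card T = t - 1 \<and> good (insert i T)"
  shows "\<exists>U\<subseteq>R. tiled good U \<and> card (R - U) \<le> M"
  using assms
proof (induction "card R" arbitrary: R rule: less_induct)
  case less
  show ?case
  proof (cases "card R \<le> M")
    case True
    then show ?thesis by (metis Diff_empty empty_subsetI tiled.empty)
  next
    case False
    then obtain i where i: "i \<in> R" by fastforce
    then have "M \<le> card (R - {i})" using False less.prems(1) by simp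
    then obtain T where T: "T \<subseteq> R - {i}" "good (insert i T)"
      using less.prems(3)[of i "R - {i}"] i by blast
    let ?R = "R - insert i T"
    have "card ?R < card R"
      by (rule psubset_card_mono) (use i less.prems(1) in auto)
    then have "\<exists>U\<subseteq>?R. tiled good U \<and> card (?R - U) \<le> M"
    proof (rule less.hyps)
      fix j J assume "j \<in> ?R" "J \<subseteq> ?R" "j \<notin> J" "M \<le> card J"
      then show "\<exists>T\<subseteq>J. card T = t - 1 \<and> good (insert j T)"
        by (intro less.prems(3)) auto
    qed (use less.prems in auto)
    then obtain U where U: "U \<subseteq> ?R" "tiled good U" "card (?R - U) \<le> M" by blast
    have "tiled good (insert i T \<union> U)"
      using T U by (intro tiled.insert_tile) auto
    moreover have "R - (insert i T \<union> U) = ?R - U" by auto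
    moreover have "insert i T \<union> U \<subseteq> R" using T U i by auto
    ultimately show ?thesis using U by metis
  qed
qed

text \<open>Each leftover element consumes \<open>t - 1\<close> elements of the reservoir
  \<open>W\<close>. The assumed size keeps at least \<open>M\<close> of them available up to the
  last leftover element.\<close>

lemma absorb_leftover:
  assumes "finite L" "finite W" "L \<inter> W = {}" "M + (t - 1) * card L \<le> card W"
    and "\<And>i J. i \<in> L \<Longrightarrow> J \<subseteq> W \<Longrightarrow> M \<le> card J \<Longrightarrow>
      \<exists>T\<subseteq>J. card T = t - 1 \<and> good (insert i T)"
  shows "\<exists>W'\<subseteq>W. tiled good (L \<union> W')"
  using assms
proof (induction L arbitrary: W rule: finite_induct)
  case empty
  then show ?case by (metis empty_subsetI sup_bot.right_neutral tiled.empty)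
next
  case (insert i L)
  have "M \<le> card W" using insert.prems(3) by linarith
  then obtain T where T: "T \<subseteq> W" "card T = t - 1" "good (insert i T)"
    using insert.prems(4)[of i W] by blast
  have "finite T" using T insert.prems(1) finite_subset by blast
  then have "card (W - T) = card W - (t - 1)" using T by (simp add: card_Diff_subset)
  moreover have "(t - 1) * card (insert i L) = (t - 1) + (t - 1) * card L"
    using insert.hyps by simp
  ultimately have c: "M + (t - 1) * card L \<le> card (W - T)" using insert.prems(3) by linarith
  have "\<exists>W'\<subseteq>W - T. tiled good (L \<union> W')"
  proof (rule insert.IH)
    fix j J assume "j \<in> L" "J \<subseteq> W - T" "M \<le> card J"
    then show "\<exists>T\<subseteq>J. card T = t - 1 \<and> good (insert j T)"
      by (intro insert.prems(4)) auto
  qed (use insert.prems c in auto)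
  then obtain W' where W': "W' \<subseteq> W - T" "tiled good (L \<union> W')" by blast
  have "tiled good (insert i T \<union> (L \<union> W'))"
    by (rule tiled.insert_tile[OF T(3) W'(2)]) (use T W' insert.prems(2) insert.hyps in auto)
  moreover have "insert i T \<union> (L \<union> W') = insert i L \<union> (T \<union> W')" by auto
  moreover have "T \<union> W' \<subseteq> W" using T W' by auto
  ultimately show ?case by metis
qed

text \<open>The interface between graphs and tilings. The constant \<open>M\<close> will be fixed
  before the number \<open>m\<close> of parts.\<close>

definition completable :: "nat \<Rightarrow> nat \<Rightarrow> nat \<Rightarrow> (nat set \<Rightarrow> bool) \<Rightarrow> bool" where
  "completable M t m good \<longleftrightarrow> (\<forall>i<m. \<forall>J\<subseteq>{..<m}. i \<notin> J \<longrightarrow> M \<le> card J \<longrightarrow>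
    (\<exists>T\<subseteq>J. card T = t - 1 \<and> good (insert i T)))"

lemma completableD:
  assumes "completable M t m good" "i < m" "J \<subseteq> {..<m}" "i \<notin> J" "M \<le> card J"
  shows "\<exists>T\<subseteq>J. card T = t - 1 \<and> good (insert i T)"
  using assms unfolding completable_def by meson

text \<open>Colour the \<open>t\<close>-sets by being good or not. Ramsey's theorem gives either the
  desired set or a large set without good \<open>t\<close>-subsets, and completing one element
  inside the latter is contradictory.\<close>

lemma ex_uniformly_good_set:
  assumes "t > 0"
  shows "\<exists>R::nat. \<forall>m\<ge>R. \<forall>good. completable M t m good \<longrightarrow>
    (\<exists>W\<subseteq>{..<m}. card W = N \<and> (\<forall>T\<subseteq>W. card T = t \<longrightarrow> good T))"
proof -
  \<comment> \<open>Removing one element from a set of size \<open>Suc M + t\<close> leaves at least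
    \<open>M\<close> others to complete it with.\<close>
  obtain R where R: "partn_lst {..<R::nat} [N, Suc M + t] t"
    using ramsey_full by blast
  have "\<exists>W\<subseteq>{..<m}. card W = N \<and> (\<forall>T\<subseteq>W. card T = t \<longrightarrow> good T)"
    if "m \<ge> R" and P: "completable M t m good" for m good
  proof -
    define f :: "nat set \<Rightarrow> nat" where "f T = (if good T then 0 else 1)" for T
    have "partn_lst {..<m} [N, Suc M + t] t"
      using R \<open>m \<ge> R\<close> by (rule partn_lst_greater_resource)
    moreover have "f \<in> nsets {..<m} t \<rightarrow> {..<2}" by (auto simp: f_def)
    ultimately obtain i H where "i < length [N, Suc M + t]"
      and H: "H \<in> nsets {..<m} ([N, Suc M + t] ! i)" "f ` nsets H t \<subseteq> {i}"
      by (rule partn_lstE) simp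
    then have i: "i < 2" by simp
    show ?thesis
    proof (cases "i = 0")
      case True
      have "good T" if "T \<subseteq> H" "card T = t" for T
      proof -
        have "finite T" using that assms card_gt_0_iff by blast
        then have "T \<in> nsets H t" using that by (simp add: nsets_def)
        then have "f T = 0" using H(2) True by blast
        then show ?thesis by (simp add: f_def split: if_splits)
      qed
      then show ?thesis using H True by (auto simp: nsets_def)
    next
      case False
      then have "i = 1" using i by simp
      then have H': "H \<subseteq> {..<m}" "finite H" "card H = Suc M + t" using H by (auto simp: nsets_def)
      then obtain a where a: "a \<in> H" by fastforce
      then have "M \<le> card (H - {a})" using H' by simp
      moreover have "a < m" "H - {a} \<subseteq> {..<m}" using a H' by auto
      ultimately obtain T where T: "T \<subseteq> H - {a}" "card T = t - 1" "good (insert a T)"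
        using completableD[OF P, of a "H - {a}"] by blast
      have "finite T" using T H' by (meson finite_Diff finite_subset)
      moreover have "a \<notin> T" using T by auto
      ultimately have "card (insert a T) = t" using T assms by simp
      then have "insert a T \<in> nsets H t"
        using T a \<open>finite T\<close> by (auto simp: nsets_def)
      then have "f (insert a T) = 1" using H \<open>i = 1\<close> by auto
      then show ?thesis using T by (simp add: f_def)
    qed
  qed
  then show ?thesis by (intro exI[of _ R]) simp
qed

lemma ex_tiling:
  assumes "t > 0"
  shows "\<exists>R::nat. \<forall>m\<ge>R. \<forall>good. t dvd m \<longrightarrow> (\<forall>T. good T \<longrightarrow> finite T \<and> card T = t) \<longrightarrow>
    completable M t m good \<longrightarrow> tiled good {..<m}"
proof -
  \<comment> \<open>The greedy phase leaves at most \<open>M\<close> parts outside the reservoir.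
    Absorbing them costs at most \<open>(t - 1) * M\<close> of its elements, and the other
    \<open>M\<close> keep completion possible throughout.\<close>
  obtain R :: nat where R: "\<And>m good. m \<ge> R \<Longrightarrow> completable M t m good \<Longrightarrow>
    (\<exists>W\<subseteq>{..<m}. card W = M + (t - 1) * M \<and> (\<forall>T\<subseteq>W. card T = t \<longrightarrow> good T))"
    using ex_uniformly_good_set[OF assms, of M "M + (t - 1) * M"] by meson
  have "tiled good {..<m}" if "m \<ge> R" "t dvd m" and good: "\<And>T. good T \<Longrightarrow> finite T \<and> card T = t"
    and P: "completable M t m good" for m good
  proof -
    obtain W where W: "W \<subseteq> {..<m}" "card W = M + (t - 1) * M" "\<And>T. T \<subseteq> W \<Longrightarrow> card T = t \<Longrightarrow> good T"
      using R[OF \<open>m \<ge> R\<close> P] by blast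
    have fW: "finite W" using W finite_subset by blast
    have "\<exists>U\<subseteq>{..<m} - W. tiled good U \<and> card (({..<m} - W) - U) \<le> M"
    proof (rule greedy_tiling[of _ t])
      fix i J assume "i \<in> {..<m} - W" "J \<subseteq> {..<m} - W" "i \<notin> J" "M \<le> card J"
      then show "\<exists>T\<subseteq>J. card T = t - 1 \<and> good (insert i T)"
        by (intro completableD[OF P]) auto
    qed (use assms in auto)
    then obtain U where U: "U \<subseteq> {..<m} - W" "tiled good U" "card (({..<m} - W) - U) \<le> M"
      by blast
    let ?L = "({..<m} - W) - U"
    have "\<exists>W'\<subseteq>W. tiled good (?L \<union> W')"
    proof (rule absorb_leftover[where M = M and t = t])
      show "M + (t - 1) * card ?L \<le> card W" using U W by simp
      fix i J assume i: "i \<in> ?L" and J: "J \<subseteq> W" "M \<le> card J"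
      have "i < m" "J \<subseteq> {..<m}" "i \<notin> J" using i J W by auto
      then show "\<exists>T\<subseteq>J. card T = t - 1 \<and> good (insert i T)"
        by (intro completableD[OF P _ _ _ J(2)])
    qed (use fW in auto)
    then obtain W' where W': "W' \<subseteq> W" "tiled good (?L \<union> W')" by blast
    have "tiled good (U \<union> (?L \<union> W'))"
      by (rule tiled_Un[OF U(2) W'(2)]) (use U W' in auto)
    moreover have "U \<union> (?L \<union> W') = {..<m} - (W - W')" using U W' W by auto
    ultimately have T: "tiled good ({..<m} - (W - W'))" by simp
    \<comment> \<open>Everything but \<open>W - W'\<close> is tiled, so its size is a multiple of
      \<open>t\<close>. Since \<open>t\<close> divides \<open>m\<close>, the rest of the reservoir
      can be cut into \<open>t\<close>-sets as well.\<close>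
    have "card ({..<m} - (W - W')) = m - card (W - W')"
      using W fW by (subst card_Diff_subset) auto
    moreover have "t dvd card ({..<m} - (W - W'))"
      using tiled_enumerate[OF T good] by auto
    ultimately have "t dvd m - card (W - W')" by simp
    moreover have "card (W - W') \<le> m"
      using card_mono[of "{..<m}" "W - W'"] W by auto
    ultimately have d: "t dvd card (W - W')"
      using \<open>t dvd m\<close> dvd_diffD1 by blast
    have "tiled good (W - W')"
      by (rule tiled_if_all_good[OF _ d assms]) (use fW W in auto)
    then have "tiled good (({..<m} - (W - W')) \<union> (W - W'))"
      by (rule tiled_Un[OF T]) auto
    moreover have "({..<m} - (W - W')) \<union> (W - W') = {..<m}" using W by auto
    ultimately show ?thesis by simp
  qed
  then show ?thesis by (intro exI[of _ R]) simp
qed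

section \<open>Rooted complete bipartite graphs\<close>

lemma ex_ge_average:
  fixes f :: "'a \<Rightarrow> real"
  assumes "finite A" "A \<noteq> {}" "c * real (card A) \<le> sum f A"
  shows "\<exists>a\<in>A. c \<le> f a"
proof (rule ccontr)
  assume "\<not> ?thesis"
  then have "sum f A < (\<Sum>a\<in>A. c)"
    using assms by (intro sum_strict_mono) auto
  then show False using assms(3) by (simp add: mult.commute)
qed

lemma sum_PiE_insert:
  assumes "j \<notin> S"
  shows "(\<Sum>x\<in>PiE (insert j S) V. h x) = (\<Sum>a\<in>V j. \<Sum>g\<in>PiE S V. h (g(j := a)))"
proof -
  have "(\<Sum>x\<in>PiE (insert j S) V. h x) = (\<Sum>(a, g)\<in>V j \<times> PiE S V. h (g(j := a)))"
    unfolding PiE_insert_eq using assms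
    by (subst sum.reindex[OF inj_combinator]) (auto simp: case_prod_unfold)
  then show ?thesis by (simp add: sum.cartesian_product)
qed

text \<open>For uniformly chosen \<open>x\<close>, the coordinates \<open>x j\<close> and
  \<open>x k\<close> are independent and uniform. In counting form, fixing both leaves the same
  number of choices for the remaining coordinates.\<close>

lemma sum_PiE_two_coordinates:
  fixes w :: "'b \<Rightarrow> 'b \<Rightarrow> real"
  assumes "finite J" "j \<in> J" "k \<in> J" "j \<noteq> k" "\<And>i. i \<in> J \<Longrightarrow> finite (V i)"
    "\<And>i. i \<in> J \<Longrightarrow> V i \<noteq> {}"
  shows "(\<Sum>x\<in>PiE J V. w (x j) (x k)) =
    (\<Sum>a\<in>V j. \<Sum>b\<in>V k. w a b) / (real (card (V j)) * real (card (V k))) * real (card (PiE J V))"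
proof -
  define S where "S = J - {j, k}"
  have J: "J = insert j (insert k S)" "j \<notin> insert k S" "k \<notin> S" "finite S"
    using assms by (auto simp: S_def)
  have "(\<Sum>x\<in>PiE J V. w (x j) (x k)) = (\<Sum>a\<in>V j. \<Sum>b\<in>V k. w a b) * real (card (PiE S V))"
    unfolding J(1) sum_PiE_insert[OF J(2)] sum_PiE_insert[OF J(3)]
    using \<open>j \<noteq> k\<close> by (simp add: sum_distrib_right sum_distrib_left mult.commute)
  moreover have "card (PiE J V) = card (V j) * card (V k) * card (PiE S V)"
    using J by (simp add: card_PiE J(1))
  moreover have "card (V j) > 0" "card (V k) > 0"
    using assms by (auto simp: card_gt_0_iff)
  ultimately show ?thesis by simp
qed

text \<open>First moment method: the left-hand side is the mean of the right-hand side over all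
  choices \<open>x\<close>.\<close>

lemma ex_choice_ge_average:
  fixes w :: "'i \<Rightarrow> 'i \<Rightarrow> 'b \<Rightarrow> 'b \<Rightarrow> real"
  assumes "finite J" "\<And>i. i \<in> J \<Longrightarrow> finite (V i)" "\<And>i. i \<in> J \<Longrightarrow> V i \<noteq> {}"
  shows "\<exists>x\<in>PiE J V.
    (\<Sum>j\<in>J. \<Sum>k\<in>J - {j}. (\<Sum>a\<in>V j. \<Sum>b\<in>V k. w j k a b) / (real (card (V j)) * real (card (V k))))
      \<le> (\<Sum>j\<in>J. \<Sum>k\<in>J - {j}. w j k (x j) (x k))"
proof (rule ex_ge_average)
  show "finite (PiE J V)" using assms by (simp add: finite_PiE)
  show "PiE J V \<noteq> {}" using assms by (simp add: PiE_eq_empty_iff)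
  have "(\<Sum>x\<in>PiE J V. \<Sum>j\<in>J. \<Sum>k\<in>J - {j}. w j k (x j) (x k)) =
      (\<Sum>j\<in>J. \<Sum>k\<in>J - {j}. \<Sum>x\<in>PiE J V. w j k (x j) (x k))"
    by (subst sum.swap, intro sum.cong refl, subst sum.swap) simp
  also have "\<dots> = (\<Sum>j\<in>J. \<Sum>k\<in>J - {j}. (\<Sum>a\<in>V j. \<Sum>b\<in>V k. w j k a b) /
      (real (card (V j)) * real (card (V k))) * real (card (PiE J V)))"
    using assms by (intro sum.cong refl sum_PiE_two_coordinates) auto
  finally show "(\<Sum>j\<in>J. \<Sum>k\<in>J - {j}. (\<Sum>a\<in>V j. \<Sum>b\<in>V k. w j k a b) /
      (real (card (V j)) * real (card (V k)))) * real (card (PiE J V)) \<le>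
      (\<Sum>x\<in>PiE J V. \<Sum>j\<in>J. \<Sum>k\<in>J - {j}. w j k (x j) (x k))"
    by (simp add: sum_distrib_right)
qed

section \<open>Bicliques in dense digraphs\<close>

lemma card_ge_of_sum_ge:
  fixes f :: "'a \<Rightarrow> real"
  assumes "finite A" "\<And>a. a \<in> A \<Longrightarrow> f a \<le> q" "0 \<le> s" "0 \<le> q"
  shows "sum f A \<le> q * real (card {a \<in> A. s \<le> f a}) + s * real (card A)"
proof -
  \<comment> \<open>Terms below the level \<open>s\<close> contribute at most \<open>s\<close>, all
    others at most \<open>q\<close>.\<close>
  have "sum f A \<le> (\<Sum>a\<in>A. q * of_bool (s \<le> f a) + s)"
    using assms by (intro sum_mono) fastforce
  also have "\<dots> = q * real (card {a \<in> A. s \<le> f a}) + s * real (card A)"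
    using \<open>finite A\<close>
    by (simp add: sum.distrib sum_distrib_left[symmetric] sum_of_bool_eq Int_def mult.commute)
  finally show ?thesis .
qed

lemma card_eq_sum_slices:
  assumes "finite J" "R \<subseteq> J \<times> J"
  shows "card R = (\<Sum>j\<in>J. card {k \<in> J. (j, k) \<in> R})"
proof -
  have "R = Sigma J (\<lambda>j. {k \<in> J. (j, k) \<in> R})" using assms by auto
  then have "card R = card (Sigma J (\<lambda>j. {k \<in> J. (j, k) \<in> R}))" by simp
  then show ?thesis using assms by simp
qed

text \<open>A Kovari-Sos-Turan argument: a bounded number of vertices of large out-degree suffices,
  since many vertices then have the same trace on them.\<close>

lemma dense_digraph_biclique:
  assumes "c > 0"
  shows "\<exists>M::nat. \<forall>(J :: 'i set) R. finite J \<longrightarrow> M \<le> card J \<longrightarrow> R \<subseteq> J \<times> J \<longrightarrow>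
    c * real (card J) ^ 2 \<le> real (card R) \<longrightarrow>
    (\<exists>S T. S \<subseteq> J \<and> T \<subseteq> J \<and> card S = s \<and> card T = s \<and> S \<times> T \<subseteq> R)"
proof -
  \<comment> \<open>By \<open>4 * s \<le> c * q\<close>, vertices hit by fewer than \<open>s\<close>
    of \<open>q\<close> chosen vertices account for at most half of the
    \<open>q * (c * n / 2)\<close> guaranteed incidences.\<close>
  define q where "q = nat \<lceil>4 * real s / c\<rceil>"
  \<comment> \<open>The first summand yields \<open>q\<close> vertices of out-degree at least
    \<open>c * n / 2\<close>, the second makes \<open>B\<close> have at least
    \<open>s * 2 ^ q\<close> elements, and \<open>1\<close> makes \<open>n\<close> positive.\<close>
  define M where "M = nat \<lceil>2 * real q / c\<rceil> + nat \<lceil>4 * real (s * 2 ^ q) / c\<rceil> + 1"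
  have "4 * real s / c \<le> real q" unfolding q_def by (rule real_nat_ceiling_ge)
  then have q: "4 * real s \<le> c * real q" using assms by (simp add: field_simps)
  have "\<exists>S T. S \<subseteq> J \<and> T \<subseteq> J \<and> card S = s \<and> card T = s \<and> S \<times> T \<subseteq> R"
    if J: "finite J" "M \<le> card J" "R \<subseteq> J \<times> J" "c * real (card J) ^ 2 \<le> real (card R)"
    for J :: "'i set" and R
  proof -
    define n where "n = real (card J)"
    have n: "2 * real q \<le> c * n" "4 * real (s * 2 ^ q) \<le> c * n" "n > 0"
    proof -
      have "2 * real q / c \<le> n"
        using J(2) real_nat_ceiling_ge[of "2 * real q / c"] by (simp add: M_def n_def)
      then show "2 * real q \<le> c * n" using assms by (simp add: field_simps)
      have "4 * real (s * 2 ^ q) / c \<le> n"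
        using J(2) real_nat_ceiling_ge[of "4 * real (s * 2 ^ q) / c"] by (simp add: M_def n_def)
      then show "4 * real (s * 2 ^ q) \<le> c * n" using assms by (simp add: field_simps)
      show "n > 0" using J(2) by (simp add: M_def n_def)
    qed
    define d where "d j = real (card {k \<in> J. (j, k) \<in> R})" for j
    have "c * n ^ 2 \<le> (\<Sum>j\<in>J. d j)"
      using J card_eq_sum_slices[of J R] by (simp add: d_def n_def)
    also have "\<dots> \<le> n * real (card {j \<in> J. c * n / 2 \<le> d j}) + c * n / 2 * real (card J)"
      using J assms n by (intro card_ge_of_sum_ge) (auto simp: d_def n_def intro!: card_mono)
    finally have "n * (c * n / 2) \<le> n * real (card {j \<in> J. c * n / 2 \<le> d j})"
      by (simp add: n_def power2_eq_square field_simps)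
    then have "real q \<le> real (card {j \<in> J. c * n / 2 \<le> d j})"
      using n by simp
    then obtain K where K: "K \<subseteq> {j \<in> J. c * n / 2 \<le> d j}" "card K = q" "finite K"
      by (meson obtain_subset_with_card_n of_nat_le_iff)
    define tr where "tr k = {j \<in> K. (j, k) \<in> R}" for k
    have "real q * (c * n / 2) \<le> (\<Sum>j\<in>K. d j)"
      using sum_bounded_below[of K "c * n / 2" d] K by auto
    also have "\<dots> = (\<Sum>k\<in>J. real (card (tr k)))"
      unfolding d_def tr_def of_nat_sum[symmetric] of_nat_eq_iff
      using K J by (intro sum_multicount_gen) auto
    also have "\<dots> \<le> real q * real (card {k \<in> J. real s \<le> real (card (tr k))}) + real s * real (card J)"
      using J K by (intro card_ge_of_sum_ge) (auto simp: tr_def intro!: card_mono)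
    finally have 1: "real q * (c * n / 2) \<le>
      real q * real (card {k \<in> J. s \<le> card (tr k)}) + real s * n" by (simp add: n_def)
    define B where "B = {k \<in> J. s \<le> card (tr k)}"
    have "s * 2 ^ q \<le> card B"
    proof (cases "s = 0")
      case False
      then have "real q > 0" using q assms by (cases "q = 0") auto
      have "4 * real s * n \<le> c * real q * n" using q n by simp
      then have "real q * (c * n / 4) \<le> real q * real (card B)"
        using 1 by (simp add: B_def field_simps)
      then have "c * n / 4 \<le> real (card B)" using \<open>real q > 0\<close> by simp
      then have "real (s * 2 ^ q) \<le> real (card B)" using n by linarith
      then show ?thesis by (simp only: of_nat_le_iff)
    qed simp
    \<comment> \<open>There are only \<open>2 ^ q\<close> subsets of \<open>K\<close>, so one trace
      \<open>S\<close> is shared by \<open>s\<close> vertices of \<open>B\<close>; these form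
      \<open>T\<close>, and the other side is taken inside \<open>S\<close>.\<close>
    moreover have "\<exists>S\<in>Pow K. card B \<le> card (tr -` {S} \<inter> B) * card (Pow K)"
      using J K by (intro pigeonhole_card) (auto simp: tr_def B_def)
    then obtain S where S: "S \<subseteq> K" "card B \<le> card (tr -` {S} \<inter> B) * 2 ^ q"
      using K by (auto simp: card_Pow)
    ultimately have "s * 2 ^ q \<le> card (tr -` {S} \<inter> B) * 2 ^ q" by linarith
    then have "s \<le> card (tr -` {S} \<inter> B)" by simp
    then obtain T where T: "T \<subseteq> tr -` {S} \<inter> B" "card T = s"
      by (meson obtain_subset_with_card_n)
    show ?thesis
    proof (cases "s = 0")
      case True
      then show ?thesis by (intro exI[of _ "{}"]) simp
    next
      case False
      then obtain k where "k \<in> T" using T by fastforce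
      then have "s \<le> card S" using T by (auto simp: B_def)
      then obtain S' where S': "S' \<subseteq> S" "card S' = s"
        by (meson obtain_subset_with_card_n)
      have "tr k = S" if "k \<in> T" for k using T that by auto
      then have "S' \<times> T \<subseteq> R" using S' by (auto simp: tr_def)
      moreover have "S' \<subseteq> J" using S' S K by auto
      moreover have "T \<subseteq> J" using T by (auto simp: B_def)
      ultimately show ?thesis using S' T by blast
    qed
  qed
  then show ?thesis by (intro exI[of _ M]) simp
qed


text \<open>Stated for a symmetric relation and without division, so that averaging runs over
  indicator sums instead of sets of edges.\<close>

definition dense_system :: "real \<Rightarrow> ('i \<Rightarrow> 'b set) \<Rightarrow> ('b \<Rightarrow> 'b \<Rightarrow> bool) \<Rightarrow> 'i set \<Rightarrow> bool" where
  "dense_system \<gamma> V adj I \<longleftrightarrow> symp adj \<and> (\<forall>j\<in>I. finite (V j) \<and> V j \<noteq> {}) \<and>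
    (\<forall>j\<in>I. \<forall>k\<in>I. j \<noteq> k \<longrightarrow>
      \<gamma> * (real (card (V j)) * real (card (V k))) \<le> (\<Sum>a\<in>V j. \<Sum>b\<in>V k. of_bool (adj a b)))"

text \<open>Adding \<open>v\<close> to the vertices indexed by \<open>T\<close> gives a complete
  bipartite graph with sides \<open>s\<close> and \<open>s + 1\<close> that uses the prescribed part
  \<open>i\<close>.\<close>

definition rooted_biclique ::
  "('i \<Rightarrow> 'b set) \<Rightarrow> ('b \<Rightarrow> 'b \<Rightarrow> bool) \<Rightarrow> nat \<Rightarrow> 'i \<Rightarrow> 'i set \<Rightarrow> bool" where
  "rooted_biclique V adj s i J \<longleftrightarrow> (\<exists>v\<in>V i. \<exists>x\<in>PiE J V. \<exists>S T. S \<subseteq> J \<and> T \<subseteq> J \<and> S \<inter> T = {} \<and>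
    card S = s \<and> card T = s \<and> (\<forall>j\<in>S. adj v (x j)) \<and> (\<forall>j\<in>S. \<forall>k\<in>T. adj (x j) (x k)))"

text \<open>First \<open>v\<close> and then \<open>x\<close> is chosen by averaging, so that the
  pairs \<open>(j, k)\<close> for which \<open>v\<close>, \<open>x j\<close>, \<open>x k\<close> is
  a path form a dense digraph on \<open>J\<close>. A biclique in this digraph is the one
  sought.\<close>

lemma ex_rooted_biclique:
  fixes \<gamma> :: real
  assumes \<gamma>: "(1 - \<gamma>) ^ 2 < \<gamma>" and "s > 0"
  shows "\<exists>M. \<forall>(V :: 'i \<Rightarrow> 'b set) adj i J. finite J \<longrightarrow> i \<notin> J \<longrightarrow> M \<le> card J \<longrightarrow>
    dense_system \<gamma> V adj (insert i J) \<longrightarrow> rooted_biclique V adj s i J"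
proof -
  define \<delta> where "\<delta> = \<gamma> - (1 - \<gamma>) ^ 2"
  have "\<delta> > 0" using \<gamma> by (simp add: \<delta>_def)
  then obtain M0 :: nat where M0: "\<forall>(J :: 'i set) R. finite J \<longrightarrow> M0 \<le> card J \<longrightarrow> R \<subseteq> J \<times> J \<longrightarrow>
    \<delta> / 4 * real (card J) ^ 2 \<le> real (card R) \<longrightarrow>
    (\<exists>S T. S \<subseteq> J \<and> T \<subseteq> J \<and> card S = s \<and> card T = s \<and> S \<times> T \<subseteq> R)"
    using dense_digraph_biclique[of "\<delta> / 4" s, where 'i = 'i] by auto
  \<comment> \<open>The second summand makes \<open>\<gamma> * n\<close>, the loss from omitting the
    pairs with \<open>j = k\<close>, at most half of \<open>\<delta> * n ^ 2\<close>. A further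
    factor two comes from \<open>D j k + D k j\<close>, whence \<open>\<delta> / 4\<close>
    above.\<close>
  define M where "M = M0 + nat \<lceil>2 * \<gamma> / \<delta>\<rceil>"
  show ?thesis
  proof (intro exI[of _ M] allI impI)
    fix V :: "'i \<Rightarrow> 'b set" and adj i J
    assume J: "finite J" "i \<notin> J" "M \<le> card J" and sys: "dense_system \<gamma> V adj (insert i J)"
    have adj: "symp adj" using sys by (simp add: dense_system_def)
    have V: "finite (V j) \<and> V j \<noteq> {}" if "j \<in> insert i J" for j
      using sys that unfolding dense_system_def by blast
    have dens: "\<gamma> * (real (card (V j)) * real (card (V k))) \<le> (\<Sum>a\<in>V j. \<Sum>b\<in>V k. of_bool (adj a b))"
      if "j \<in> insert i J" "k \<in> insert i J" "j \<noteq> k" for j k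
      using sys that unfolding dense_system_def by blast
    define n where "n = real (card J)"
    have "2 * \<gamma> / \<delta> \<le> n"
      using J(3) real_nat_ceiling_ge[of "2 * \<gamma> / \<delta>"] unfolding M_def n_def by linarith
    then have n: "2 * \<gamma> \<le> \<delta> * n" using \<open>\<delta> > 0\<close> by (simp add: field_simps)
    have pos: "real (card (V j)) > 0" if "j \<in> insert i J" for j
      using V[OF that] by (simp add: card_gt_0_iff)
    \<comment> \<open>Interchanging the sums over \<open>J\<close> and \<open>V i\<close> bounds
      from below the mean, over \<open>v\<close>, of the total proportion of neighbours; some
      \<open>v\<close> is at least average.\<close>
    have "\<gamma> * n * real (card (V i)) \<le> (\<Sum>j\<in>J. (\<Sum>v\<in>V i. \<Sum>a\<in>V j. of_bool (adj v a)) / real (card (V j)))"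
    proof -
      have "\<gamma> * real (card (V i)) \<le> (\<Sum>v\<in>V i. \<Sum>a\<in>V j. of_bool (adj v a)) / real (card (V j))"
        if "j \<in> J" for j
        using dens[of i j] pos[of j] that J(2) by (auto simp: field_simps)
      then show ?thesis
        using sum_bounded_below[of J "\<gamma> * real (card (V i))"] by (simp add: n_def mult.assoc mult.left_commute)
    qed
    also have "\<dots> = (\<Sum>v\<in>V i. \<Sum>j\<in>J. (\<Sum>a\<in>V j. of_bool (adj v a)) / real (card (V j)))"
      by (simp add: sum_divide_distrib sum.swap[of _ J])
    finally obtain v where v: "v \<in> V i"
      "\<gamma> * n \<le> (\<Sum>j\<in>J. (\<Sum>a\<in>V j. of_bool (adj v a)) / real (card (V j)))"
      using ex_ge_average[of "V i" "\<gamma> * n"] V[of i] by auto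
    define \<beta> where "\<beta> j = (\<Sum>a\<in>V j. of_bool (\<not> adj v a)) / real (card (V j))" for j
    have \<beta>_nonneg: "\<beta> j \<ge> 0" for j by (simp add: \<beta>_def sum_nonneg)
    have "(\<Sum>a\<in>V j. of_bool (adj v a)) / real (card (V j)) = 1 - \<beta> j" if "j \<in> J" for j
    proof -
      have "(\<Sum>a\<in>V j. of_bool (adj v a)) + (\<Sum>a\<in>V j. of_bool (\<not> adj v a)) = real (card (V j))"
        by (simp add: of_bool_not_iff sum_subtractf)
      then show ?thesis using pos[of j] that by (simp add: \<beta>_def field_simps)
    qed
    then have "\<gamma> * n \<le> n - sum \<beta> J"
      using v(2) by (simp add: sum_subtractf n_def)
    then have \<beta>_sum: "(sum \<beta> J)\<^sup>2 \<le> ((1 - \<gamma>) * n)\<^sup>2"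
      using \<beta>_nonneg by (intro power_mono) (simp_all add: sum_nonneg algebra_simps)
    \<comment> \<open>D j k is the density of edges leaving the neighbourhood of v in the part j towards the part k.\<close>
    define w :: "'b \<Rightarrow> 'b \<Rightarrow> real" where "w a b = of_bool (adj v a \<and> adj a b)" for a b
    define D where "D j k = (\<Sum>a\<in>V j. \<Sum>b\<in>V k. w a b) / (real (card (V j)) * real (card (V k)))" for j k
    have "\<gamma> - \<beta> j * \<beta> k \<le> D j k + D k j" if "j \<in> J" "k \<in> J" "j \<noteq> k" for j k
    proof -
      have "\<gamma> * (real (card (V j)) * real (card (V k))) \<le> (\<Sum>a\<in>V j. \<Sum>b\<in>V k. of_bool (adj a b))"
        using dens that by auto
      \<comment> \<open>An edge has its first end adjacent to \<open>v\<close>, or its second end,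
        or both ends outside the neighbourhood of \<open>v\<close>.\<close>
      also have "\<dots> \<le> (\<Sum>a\<in>V j. \<Sum>b\<in>V k. w a b + w b a + of_bool (\<not> adj v a) * of_bool (\<not> adj v b))"
        using adj by (intro sum_mono) (auto simp: w_def dest: sympD)
      also have "\<dots> = (\<Sum>a\<in>V j. \<Sum>b\<in>V k. w a b) + (\<Sum>b\<in>V k. \<Sum>a\<in>V j. w b a) +
          (\<Sum>a\<in>V j. of_bool (\<not> adj v a)) * (\<Sum>b\<in>V k. of_bool (\<not> adj v b))"
        by (simp only: sum.distrib sum_product sum.swap[of "\<lambda>a b. w b a" "V k" "V j"])
      also have "\<dots> = (D j k + D k j + \<beta> j * \<beta> k) * (real (card (V j)) * real (card (V k)))"
        using pos[of j] pos[of k] that by (simp add: D_def \<beta>_def field_simps)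
      finally show ?thesis
        using pos[of j] pos[of k] that by simp
    qed
    then have "(\<Sum>j\<in>J. \<Sum>k\<in>J - {j}. \<gamma> - \<beta> j * \<beta> k) \<le> (\<Sum>j\<in>J. \<Sum>k\<in>J - {j}. D j k + D k j)"
      by (intro sum_mono) auto
    also have "\<dots> = 2 * (\<Sum>j\<in>J. \<Sum>k\<in>J - {j}. D j k)"
    proof -
      have "(\<Sum>j\<in>J. \<Sum>k\<in>J - {j}. D k j) = (\<Sum>j\<in>J. \<Sum>k\<in>J - {j}. D j k)"
        using sum.swap_restrict[OF J(1) J(1), of "\<lambda>j k. D k j" "\<lambda>j k. j \<noteq> k"]
        by (simp add: set_diff_eq eq_commute)
      then show ?thesis by (simp add: sum.distrib)
    qed
    finally have "(\<Sum>j\<in>J. \<Sum>k\<in>J - {j}. \<gamma> - \<beta> j * \<beta> k) \<le> 2 * (\<Sum>j\<in>J. \<Sum>k\<in>J - {j}. D j k)" .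
    moreover have "(\<Sum>j\<in>J. \<Sum>k\<in>J - {j}. \<gamma> - \<beta> j * \<beta> k) \<ge> \<gamma> * n * (n - 1) - (sum \<beta> J)\<^sup>2"
    proof -
      \<comment> \<open>The nonnegative diagonal terms are added to complete the square of
        \<open>sum \<beta> J\<close>.\<close>
      have "(\<Sum>j\<in>J. \<Sum>k\<in>J - {j}. \<beta> j * \<beta> k) \<le> (\<Sum>j\<in>J. \<Sum>k\<in>J. \<beta> j * \<beta> k)"
        using J(1) \<beta>_nonneg by (intro sum_mono sum_mono2) auto
      also have "\<dots> = (sum \<beta> J)\<^sup>2" by (simp add: power2_eq_square sum_product)
      finally have "(\<Sum>j\<in>J. \<Sum>k\<in>J - {j}. \<beta> j * \<beta> k) \<le> (sum \<beta> J)\<^sup>2" .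
      moreover have "(\<Sum>j\<in>J. \<Sum>k\<in>J - {j}. \<gamma>) = \<gamma> * n * (n - 1)"
      proof -
        have "(\<Sum>k\<in>J - {j}. \<gamma>) = \<gamma> * (n - 1)" if "j \<in> J" for j
        proof -
          have "card J \<ge> 1" using that J(1) by (auto simp: Suc_le_eq card_gt_0_iff)
          then show ?thesis using that J(1) by (simp add: n_def of_nat_diff mult.commute)
        qed
        then have "(\<Sum>j\<in>J. \<Sum>k\<in>J - {j}. \<gamma>) = (\<Sum>j\<in>J. \<gamma> * (n - 1))" by (rule sum.cong[OF refl])
        then show ?thesis by (simp add: n_def)
      qed
      ultimately show ?thesis by (simp only: sum_subtractf)
    qed
    ultimately have "\<gamma> * n * (n - 1) - ((1 - \<gamma>) * n)\<^sup>2 \<le> 2 * (\<Sum>j\<in>J. \<Sum>k\<in>J - {j}. D j k)"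
      using \<beta>_sum by linarith
    moreover have "\<gamma> * n * (n - 1) - ((1 - \<gamma>) * n)\<^sup>2 = \<delta> * n\<^sup>2 - \<gamma> * n"
      by (simp add: \<delta>_def power2_eq_square algebra_simps)
    moreover have "2 * \<gamma> * n \<le> \<delta> * n\<^sup>2"
      using mult_right_mono[OF n, of n] by (simp add: n_def power2_eq_square mult.assoc)
    ultimately have D: "\<delta> / 4 * n\<^sup>2 \<le> (\<Sum>j\<in>J. \<Sum>k\<in>J - {j}. D j k)" by linarith
    obtain x where x: "x \<in> PiE J V"
      "(\<Sum>j\<in>J. \<Sum>k\<in>J - {j}. D j k) \<le> (\<Sum>j\<in>J. \<Sum>k\<in>J - {j}. w (x j) (x k))"
      using ex_choice_ge_average[OF J(1), of V "\<lambda>_ _. w"] V unfolding D_def by blast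
    define R where "R = {(j, k). j \<in> J \<and> k \<in> J \<and> j \<noteq> k \<and> adj v (x j) \<and> adj (x j) (x k)}"
    have R: "R \<subseteq> J \<times> J" by (auto simp: R_def)
    have "real (card {k \<in> J. (j, k) \<in> R}) = (\<Sum>k\<in>J - {j}. w (x j) (x k))" if "j \<in> J" for j
    proof -
      have "{k \<in> J. (j, k) \<in> R} = (J - {j}) \<inter> {k. adj v (x j) \<and> adj (x j) (x k)}"
        using that by (auto simp: R_def)
      then show ?thesis using J(1) by (simp add: w_def sum_of_bool_eq)
    qed
    then have "real (card R) = (\<Sum>j\<in>J. \<Sum>k\<in>J - {j}. w (x j) (x k))"
      using card_eq_sum_slices[OF J(1) R] by simp
    then have "\<delta> / 4 * real (card J) ^ 2 \<le> real (card R)"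
      using D x(2) by (simp add: n_def)
    moreover have "M0 \<le> card J" using J(3) by (simp add: M_def)
    ultimately obtain S T where ST: "S \<subseteq> J" "T \<subseteq> J" "card S = s" "card T = s" "S \<times> T \<subseteq> R"
      using M0 J(1) R by meson
    \<comment> \<open>In \<open>R\<close> the adjacency of \<open>v\<close> to \<open>x j\<close> is
      recorded only through pairs \<open>(j, k)\<close>, so a member of \<open>T\<close> is needed
      to read it off.\<close>
    have "T \<noteq> {}" using ST \<open>s > 0\<close> by auto
    have "S \<inter> T = {}" using ST(5) by (auto simp: R_def)
    moreover have "\<forall>j\<in>S. adj v (x j)" using ST(5) \<open>T \<noteq> {}\<close> by (auto simp: R_def)
    moreover have "\<forall>j\<in>S. \<forall>k\<in>T. adj (x j) (x k)" using ST(5) by (auto simp: R_def)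
    ultimately show "rooted_biclique V adj s i J"
      unfolding rooted_biclique_def
      using v(1) x(1) ST by (intro bexI[of _ v] bexI[of _ x] exI[of _ S] exI[of _ T]) simp_all
  qed
qed

section \<open>Traversals above the threshold\<close>

lemma simple_graph_edgeE:
  assumes "simple_graph G" "e \<in> edges G"
  obtains u v where "e = {u, v}" "u \<in> verts G" "v \<in> verts G" "u \<noteq> v"
  using assms unfolding simple_graph_def by blast

lemma simple_graph_edgeD:
  assumes "simple_graph G" "{u, v} \<in> edges G"
  shows "u \<in> verts G" "v \<in> verts G" "u \<noteq> v"
  using assms by (auto elim!: simple_graph_edgeE simp: doubleton_eq_iff)

text \<open>As \<open>X\<close> and \<open>Y\<close> are disjoint, each edge between them comes from
  exactly one pair in \<open>X \<times> Y\<close>.\<close>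

lemma edge_density_eq_sum:
  assumes "finite X" "finite Y" "X \<inter> Y = {}"
  shows "edge_density G X Y =
    (\<Sum>a\<in>X. \<Sum>b\<in>Y. of_bool ({a, b} \<in> edges G)) / (real (card X) * real (card Y))"
proof -
  let ?E = "{p \<in> X \<times> Y. {fst p, snd p} \<in> edges G}"
  have "{e \<in> edges G. \<exists>x\<in>X. \<exists>y\<in>Y. e = {x, y}} = (\<lambda>p. {fst p, snd p}) ` ?E"
    by (auto simp: image_iff Bex_def) blast+
  moreover have "inj_on (\<lambda>p. {fst p, snd p}) ?E"
    using assms(3) by (auto simp: inj_on_def doubleton_eq_iff)
  ultimately have "card {e \<in> edges G. \<exists>x\<in>X. \<exists>y\<in>Y. e = {x, y}} = card ?E"
    by (simp add: card_image)
  moreover have "real (card ?E) = (\<Sum>(a, b)\<in>X \<times> Y. of_bool ({a, b} \<in> edges G))"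
    using assms by (simp add: sum_of_bool_eq case_prod_unfold Int_def mem_Times_iff)
  ultimately show ?thesis by (simp add: edge_density_def sum.cartesian_product)
qed

lemma multipartite_finite_part:
  assumes "multipartite m P G" "i < m"
  shows "finite (P i) \<and> P i \<noteq> {}"
  using assms unfolding multipartite_def simple_graph_def
  by (metis UN_upper finite_subset lessThan_iff)

lemma partite_density_le:
  assumes "i < j" "j < m"
  shows "partite_density m P G \<le> edge_density G (P i) (P j)"
  unfolding partite_density_def
proof (rule Min_le)
  have "{edge_density G (P i) (P j) |i j. i < j \<and> j < m}
      \<subseteq> (\<lambda>(i, j). edge_density G (P i) (P j)) ` ({..<m} \<times> {..<m})" by auto
  then show "finite {edge_density G (P i) (P j) |i j. i < j \<and> j < m}"
    by (rule finite_subset) simp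
qed (use assms in auto)

lemma partite_density_ge:
  assumes "1 < m" "\<And>i j. i < j \<Longrightarrow> j < m \<Longrightarrow> \<alpha> \<le> edge_density G (P i) (P j)"
  shows "\<alpha> \<le> partite_density m P G"
  unfolding partite_density_def
proof (rule Min.boundedI)
  have "{edge_density G (P i) (P j) |i j. i < j \<and> j < m}
      \<subseteq> (\<lambda>(i, j). edge_density G (P i) (P j)) ` ({..<m} \<times> {..<m})" by auto
  then show "finite {edge_density G (P i) (P j) |i j. i < j \<and> j < m}"
    by (rule finite_subset) simp
  show "{edge_density G (P i) (P j) |i j. i < j \<and> j < m} \<noteq> {}"
    using assms(1) by blast
qed (use assms in auto)

text \<open>The minimum ranges over increasing pairs of indices only; symmetry of
  \<open>{a, b}\<close> supplies the other order.\<close>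

lemma partite_density_sum:
  assumes "multipartite m P G" "\<gamma> \<le> partite_density m P G" "j < m" "k < m" "j \<noteq> k"
  shows "\<gamma> * (real (card (P j)) * real (card (P k))) \<le>
    (\<Sum>a\<in>P j. \<Sum>b\<in>P k. of_bool ({a, b} \<in> edges G))"
proof -
  have *: "\<gamma> * (real (card (P j)) * real (card (P k))) \<le>
    (\<Sum>a\<in>P j. \<Sum>b\<in>P k. of_bool ({a, b} \<in> edges G))" if "j < k" "k < m" for j k
  proof -
    have fin: "finite (P j)" "finite (P k)" "P j \<noteq> {}" "P k \<noteq> {}"
      using multipartite_finite_part[OF assms(1)] that by auto
    moreover have "P j \<inter> P k = {}" using assms(1) that by (simp add: multipartite_def)
    moreover have "\<gamma> \<le> edge_density G (P j) (P k)"
      using partite_density_le[OF that] assms(2) by (rule order_trans[rotated])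
    moreover have "real (card (P j)) * real (card (P k)) > 0"
      using fin by (simp add: card_gt_0_iff)
    ultimately show ?thesis by (simp add: edge_density_eq_sum pos_le_divide_eq)
  qed
  show ?thesis
  proof (cases "j < k")
    case False
    then have "k < j" using assms(5) by simp
    moreover have "(\<Sum>a\<in>P j. \<Sum>b\<in>P k. of_bool ({a, b} \<in> edges G)) =
        (\<Sum>a\<in>P k. \<Sum>b\<in>P j. of_bool ({a, b} \<in> edges G) :: real)"
      by (subst sum.swap) (simp add: insert_commute)
    ultimately show ?thesis
      using *[of k j] assms(3) by (simp add: mult.commute)
  qed (use * assms in simp)
qed

text \<open>Each vertex of F gets a part by \<open>p\<close> and a vertex in that part by
  \<open>f\<close>. For disjoint parts, injectivity of \<open>f\<close> follows from that of
  \<open>p\<close>.\<close>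

definition hosts :: "(nat \<Rightarrow> 'b set) \<Rightarrow> 'b graph \<Rightarrow> 'a graph \<Rightarrow> nat set \<Rightarrow> bool" where
  "hosts P G F T \<longleftrightarrow> (\<exists>f p. inj_on p (verts F) \<and> p ` verts F = T \<and>
    (\<forall>z\<in>verts F. f z \<in> P (p z)) \<and> (\<forall>e\<in>edges F. f ` e \<in> edges G))"

text \<open>The tiles use every part exactly once, so the union \<open>H\<close> of the embedded
  copies meets each part in a single vertex.\<close>

lemma has_traversal_copies:
  assumes mp: "multipartite m P G" and F: "simple_graph F"
    and Q: "\<forall>k<r. hosts P G F (Q k)" "disjoint_family_on Q {..<r}" "(\<Union>k<r. Q k) = {..<m}"
  shows "has_traversal m P G (copies r F)"
proof -
  obtain f p where fp: "\<And>k. k < r \<Longrightarrow> inj_on (p k) (verts F)" "\<And>k. k < r \<Longrightarrow> p k ` verts F = Q k"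
    "\<And>k z. k < r \<Longrightarrow> z \<in> verts F \<Longrightarrow> f k z \<in> P (p k z)"
    "\<And>k e. k < r \<Longrightarrow> e \<in> edges F \<Longrightarrow> f k ` e \<in> edges G"
    using Q(1) unfolding hosts_def by metis
  have pm: "p k z < m" if "k < r" "z \<in> verts F" for k z
    using that fp(2) Q(3) by blast
  have disj: "i = j" if "i < m" "j < m" "v \<in> P i" "v \<in> P j" for i j v
    using mp that unfolding multipartite_def by blast
  have p_inj: "k = k' \<and> z = z'"
    if "k < r" "z \<in> verts F" "k' < r" "z' \<in> verts F" "p k z = p k' z'" for k z k' z'
  proof -
    have "p k z \<in> Q k" "p k z \<in> Q k'" using that fp(2) by (metis imageI)+
    then have "k = k'" using disjoint_family_onD[OF Q(2), of k k'] that by auto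
    then show ?thesis using fp(1) that by (auto dest: inj_onD)
  qed
  have PV: "P i \<subseteq> verts G" if "i < m" for i
    using mp that unfolding multipartite_def by blast
  define H where "H = ((\<Union>k<r. f k ` verts F), (\<Union>k<r. (\<lambda>e. f k ` e) ` edges F))"
  have "simple_graph H"
    unfolding simple_graph_def
  proof
    show "finite (verts H)" using F by (simp add: H_def simple_graph_def)
    show "edges H \<subseteq> {{u, v} |u v. u \<in> verts H \<and> v \<in> verts H \<and> u \<noteq> v}"
    proof
      fix e assume "e \<in> edges H"
      then obtain k e' where k: "k < r" "e' \<in> edges F" "e = f k ` e'" by (auto simp: H_def)
      then obtain u v where uv: "e' = {u, v}" "u \<in> verts F" "v \<in> verts F" "u \<noteq> v"
        using simple_graph_edgeE[OF F] by blast
      have "f k u \<noteq> f k v"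
        using disj[OF pm pm, of k u k v "f k u"] fp(3) k uv p_inj[of k u k v] by metis
      moreover have "e = {f k u, f k v}" using k uv by simp
      moreover have "f k u \<in> verts H" "f k v \<in> verts H" using k uv by (auto simp: H_def)
      ultimately show "e \<in> {{u, v} |u v. u \<in> verts H \<and> v \<in> verts H \<and> u \<noteq> v}" by blast
    qed
  qed
  moreover have "verts H \<subseteq> verts G"
    using fp(3) pm PV by (fastforce simp: H_def)
  moreover have "edges H \<subseteq> edges G" using fp(4) by (auto simp: H_def)
  ultimately have "subgraph H G" by (simp add: subgraph_def)
  moreover have "\<exists>!v. v \<in> verts H \<inter> P i" if "i < m" for i
  proof -
    have "i \<in> (\<Union>k<r. p k ` verts F)" using that Q(3) fp(2) by auto
    then obtain k z where kz: "k < r" "z \<in> verts F" "p k z = i" by auto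
    show ?thesis
    proof
      show "f k z \<in> verts H \<inter> P i" using kz fp(3) by (auto simp: H_def)
      fix v assume v: "v \<in> verts H \<inter> P i"
      then obtain k' z' where kz': "k' < r" "z' \<in> verts F" "v = f k' z'" by (auto simp: H_def)
      then have "p k' z' = i" using disj[OF pm that, of k' z' v] fp(3) v by blast
      then show "v = f k z" using p_inj[of k' z' k z] kz kz' by simp
    qed
  qed
  ultimately have "traversal m P G H" by (simp add: traversal_def)
  moreover have "contains_copy H (copies r F)"
    unfolding contains_copy_def
  proof (intro exI[of _ "\<lambda>(k, z). f k z"] conjI)
    show "inj_on (\<lambda>(k, z). f k z) (verts (copies r F))"
    proof (rule inj_onI, clarify)
      fix k z k' z' assume a: "(k, z) \<in> verts (copies r F)" "(k', z') \<in> verts (copies r F)"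
        "f k z = f k' z'"
      then have "k < r" "z \<in> verts F" "k' < r" "z' \<in> verts F" by (auto simp: copies_def)
      then show "k = k' \<and> z = z'"
        using disj[OF pm pm, of k z k' z' "f k z"] fp(3) p_inj a(3) by metis
    qed
    show "(\<lambda>(k, z). f k z) ` verts (copies r F) \<subseteq> verts H" by (auto simp: copies_def H_def)
    show "\<forall>e\<in>edges (copies r F). (\<lambda>(k, z). f k z) ` e \<in> edges H"
    proof
      fix e assume "e \<in> edges (copies r F)"
      then obtain k e' where k: "k < r" "e' \<in> edges F" "e = Pair k ` e'" by (auto simp: copies_def)
      then have "(\<lambda>(k, z). f k z) ` e = f k ` e'" by (simp add: image_image)
      then show "(\<lambda>(k, z). f k z) ` e \<in> edges H" using k by (auto simp: H_def)
    qed
  qed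
  ultimately show ?thesis unfolding has_traversal_def by blast
qed

text \<open>A root on the first side is wanted, but the given first side may be empty. Then F has no
  edges and the sides can be swapped.\<close>

lemma bipartite_obtain_root:
  assumes "bipartite F" "verts F \<noteq> {}"
  obtains X Y c where "X \<union> Y = verts F" "X \<inter> Y = {}" "c \<in> X"
    "\<forall>e\<in>edges F. \<exists>a\<in>X. \<exists>b\<in>Y. e = {a, b}"
proof -
  obtain X Y where XY: "X \<union> Y = verts F" "X \<inter> Y = {}"
    and "edges F \<subseteq> {{x, y} |x y. x \<in> X \<and> y \<in> Y}"
    using assms(1) unfolding bipartite_def by (elim exE conjE)
  then have edge: "\<exists>a\<in>X. \<exists>b\<in>Y. e = {a, b}" if "e \<in> edges F" for e
    using that by blast
  show ?thesis
  proof (cases "X = {}")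
    case False
    then obtain c where "c \<in> X" by auto
    then show ?thesis using that[of X Y c] XY edge by simp
  next
    case True
    then obtain c where "c \<in> Y" using XY assms(2) by auto
    moreover have "edges F = {}" using True edge by blast
    ultimately show ?thesis using that[of Y X c] XY by (simp add: Un_commute Int_commute)
  qed
qed

text \<open>The root \<open>c\<close> goes to \<open>v\<close>, the rest of \<open>X\<close> into
  \<open>T\<close>, and \<open>Y\<close> into \<open>S\<close>. Neither side of F exceeds
  \<open>t\<close> vertices, and \<open>v\<close> is joined to all of \<open>S\<close> just as the
  vertices of \<open>T\<close> are.\<close>

lemma hosts_of_rooted_biclique:
  assumes F: "simple_graph F" "card (verts F) = t" "verts F \<noteq> {}" "bipartite F"
    and v: "v \<in> P i" and x: "\<And>j. j \<in> J \<Longrightarrow> x j \<in> P j" and "i \<notin> J"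
    and ST: "S \<subseteq> J" "T \<subseteq> J" "S \<inter> T = {}" "card S = t" "card T = t"
    and adj: "\<And>j. j \<in> S \<Longrightarrow> {v, x j} \<in> edges G"
      "\<And>j k. j \<in> S \<Longrightarrow> k \<in> T \<Longrightarrow> {x j, x k} \<in> edges G"
  shows "\<exists>U\<subseteq>J. card U = t - 1 \<and> hosts P G F (insert i U)"
proof -
  obtain X Y c where XY: "X \<union> Y = verts F" "X \<inter> Y = {}" "c \<in> X"
    "\<forall>e\<in>edges F. \<exists>a\<in>X. \<exists>b\<in>Y. e = {a, b}"
    by (rule bipartite_obtain_root[OF F(4,3)])
  have fin: "finite (verts F)" using F(1) by (simp add: simple_graph_def)
  then have finXY: "finite X" "finite Y" using XY(1) by (metis finite_Un)+
  have "t > 0" using F fin by (auto simp: card_gt_0_iff)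
  then have finST: "finite S" "finite T" using ST card_gt_0_iff by metis+
  have "card X \<le> card T" "card Y \<le> card S"
    using XY(1) fin F(2) ST by (metis card_mono sup_ge1 sup_ge2)+
  then obtain g h where g: "g ` X \<subseteq> T" "inj_on g X" and h: "h ` Y \<subseteq> S" "inj_on h Y"
    using card_le_inj[of X T] card_le_inj[of Y S] finXY finST by blast
  define p where "p z = (if z = c then i else if z \<in> X then g z else h z)" for z
  define f where "f z = (if z = c then v else x (p z))" for z
  have pJ: "p z \<in> J" if "z \<in> verts F" "z \<noteq> c" for z
  proof -
    have "g z \<in> J" if "z \<in> X" using that g(1) ST(2) by blast
    moreover have "h z \<in> J" if "z \<in> Y" using that h(1) ST(1) by blast
    ultimately show ?thesis using that XY(1) by (auto simp: p_def)
  qed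
  have inj: "inj_on p (verts F)"
  proof (rule inj_onI)
    fix a b assume ab: "a \<in> verts F" "b \<in> verts F" "p a = p b"
    show "a = b"
    proof (cases "a = c \<or> b = c")
      case True
      then show ?thesis using ab pJ[of a] pJ[of b] \<open>i \<notin> J\<close> by (metis p_def)
    next
      case False
      have "\<forall>y\<in>X. \<forall>z\<in>Y. g y \<noteq> h z"
        using g h ST(3) by blast
      moreover have "a \<notin> X \<Longrightarrow> a \<in> Y" "b \<notin> X \<Longrightarrow> b \<in> Y" using ab XY(1) by auto
      ultimately show ?thesis
        using ab(3) False inj_onD[OF g(2), of a b] inj_onD[OF h(2), of a b]
        by (cases "a \<in> X"; cases "b \<in> X") (simp_all add: p_def, metis)
    qed
  qed
  define U where "U = p ` (verts F - {c})"
  have c: "c \<in> verts F" using XY by auto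
  have "U \<subseteq> J" using pJ by (auto simp: U_def)
  moreover have "card U = t - 1"
    unfolding U_def using inj c F(2) fin
    by (subst card_image) (auto intro: inj_on_subset)
  moreover have "hosts P G F (insert i U)"
    unfolding hosts_def
  proof (intro exI[of _ f] exI[of _ p] conjI ballI)
    show "p ` verts F = insert i U"
      using c by (auto simp: U_def p_def)
    fix z assume "z \<in> verts F"
    then show "f z \<in> P (p z)"
      using v x pJ by (auto simp: f_def p_def)
  next
    fix e assume "e \<in> edges F"
    then obtain a b where ab: "a \<in> X" "b \<in> Y" "e = {a, b}" using XY(4) by blast
    have "f b = x (h b)" "h b \<in> S" using ab XY h by (auto simp: f_def p_def)
    moreover have "f a = v \<or> f a = x (g a) \<and> g a \<in> T" using ab g by (auto simp: f_def p_def)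
    moreover have "f ` e = {f a, f b}" "f ` e = {f b, f a}" using ab(3) by auto
    ultimately show "f ` e \<in> edges G" using adj by metis
  qed (rule inj)
  ultimately show ?thesis by blast
qed

text \<open>First \<open>M\<close> and then \<open>R\<close> is obtained from
  \<open>\<gamma>\<close> and \<open>t\<close> alone, so one bound serves all \<open>P\<close> and
  \<open>G\<close>.\<close>

lemma ex_traversal_threshold:
  fixes F :: "'a graph"
  assumes F: "simple_graph F" "card (verts F) = t" "t \<ge> 1" "bipartite F"
    and \<gamma>: "(1 - \<gamma>) ^ 2 < \<gamma>"
  shows "\<exists>R. \<forall>r\<ge>R. \<forall>(P :: nat \<Rightarrow> 'b set) G. multipartite (r * t) P G \<longrightarrow>
    \<gamma> \<le> partite_density (r * t) P G \<longrightarrow> has_traversal (r * t) P G (copies r F)"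
proof -
  have "t > 0" and ne: "verts F \<noteq> {}" and fin: "finite (verts F)"
    using F by (auto simp: simple_graph_def)
  obtain M where M: "\<forall>(V :: nat \<Rightarrow> 'b set) adj i J. finite J \<longrightarrow> i \<notin> J \<longrightarrow> M \<le> card J \<longrightarrow>
    dense_system \<gamma> V adj (insert i J) \<longrightarrow> rooted_biclique V adj t i J"
    using ex_rooted_biclique[OF \<gamma> \<open>t > 0\<close>, where 'i = nat and 'b = 'b] ..
  obtain R where R: "\<forall>m\<ge>R. \<forall>good. t dvd m \<longrightarrow> (\<forall>T. good T \<longrightarrow> finite T \<and> card T = t) \<longrightarrow>
    completable M t m good \<longrightarrow> tiled good {..<m}"
    using ex_tiling[OF \<open>t > 0\<close>, of M] by blast
  have "has_traversal (r * t) P G (copies r F)"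
    if "r \<ge> R" and mp: "multipartite (r * t) P G" and dens: "\<gamma> \<le> partite_density (r * t) P G"
    for r and P :: "nat \<Rightarrow> 'b set" and G
  proof -
    have card_hosts: "finite T \<and> card T = t" if "hosts P G F T" for T
      using that F fin by (auto simp: hosts_def card_image)
    have "completable M t (r * t) (hosts P G F)"
      unfolding completable_def
    proof (intro allI impI)
      fix i J assume iJ: "i < r * t" "J \<subseteq> {..<r * t}" "i \<notin> J" "M \<le> card J"
      then have lt: "j < r * t" if "j \<in> insert i J" for j using that by auto
      have "dense_system \<gamma> P (\<lambda>a b. {a, b} \<in> edges G) (insert i J)"
        unfolding dense_system_def
      proof (intro conjI ballI impI)
        show "symp (\<lambda>a b. {a, b} \<in> edges G)" by (auto simp: symp_def insert_commute)
      qed (use lt multipartite_finite_part[OF mp] in blast,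
          use lt multipartite_finite_part[OF mp] in blast,
          intro partite_density_sum[OF mp dens] lt)
      moreover have "finite J" using iJ finite_subset by blast
      ultimately have "rooted_biclique P (\<lambda>a b. {a, b} \<in> edges G) t i J"
        using M iJ by simp
      then obtain v x S T where "v \<in> P i" "x \<in> PiE J P" "S \<subseteq> J" "T \<subseteq> J" "S \<inter> T = {}"
        "card S = t" "card T = t" "\<forall>j\<in>S. {v, x j} \<in> edges G"
        "\<forall>j\<in>S. \<forall>k\<in>T. {x j, x k} \<in> edges G" unfolding rooted_biclique_def by blast
      then show "\<exists>T\<subseteq>J. card T = t - 1 \<and> hosts P G F (insert i T)"
        by (intro hosts_of_rooted_biclique[OF F(1,2) ne F(4), of v P i J x S T]) (use iJ in auto)
    qed
    moreover have "R \<le> r * t" using mult_le_mono[OF \<open>r \<ge> R\<close> \<open>t \<ge> 1\<close>] by simp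
    ultimately have "tiled (hosts P G F) {..<r * t}" using R card_hosts by simp
    then obtain r' Q where Q: "card {..<r * t} = r' * t" "\<forall>k<r'. hosts P G F (Q k)"
      "disjoint_family_on Q {..<r'}" "(\<Union>k<r'. Q k) = {..<r * t}"
      using tiled_enumerate[OF _ card_hosts] by blast
    then have "r' = r" using \<open>t > 0\<close> by simp
    then show ?thesis using has_traversal_copies[OF mp F(1)] Q by blast
  qed
  then show ?thesis by (intro exI[of _ R]) simp
qed

section \<open>The extremal graph\<close>

text \<open>Otherwise every neighbour of \<open>z\<close> has \<open>z\<close> as its only
  neighbour. The component of \<open>z\<close> is then a star centred at \<open>z\<close>, possibly
  a single vertex.\<close>

lemma no_star_component_path2:
  assumes F: "simple_graph F" and nsc: "no_star_component F" and z: "z \<in> verts F"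
  shows "\<exists>u w. {z, u} \<in> edges F \<and> {u, w} \<in> edges F \<and> w \<noteq> z"
proof (rule ccontr)
  assume "\<not> ?thesis"
  then have only_z: "w = z" if "{z, u} \<in> edges F" "{u, w} \<in> edges F" for u w
    using that by blast
  define N where "N = {u. {z, u} \<in> edges F}"
  define C where "C = {w. (z, w) \<in> {(x, y). {x, y} \<in> edges F}\<^sup>*}"
  have "w \<in> insert z N" if "(z, w) \<in> {(x, y). {x, y} \<in> edges F}\<^sup>*" for w
    using that by (induction rule: rtrancl_induct) (auto simp: N_def dest: only_z)
  moreover have "insert z N \<subseteq> C" by (auto simp: C_def N_def)
  ultimately have C: "C = insert z N" by (auto simp: C_def)
  have comp: "component F z = (C, {e \<in> edges F. e \<subseteq> C})"
    by (simp add: component_def C_def Let_def)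
  have "{e \<in> edges F. e \<subseteq> C} = {{z, v} |v. v \<in> C - {z}}"
  proof (intro equalityI subsetI)
    fix e assume "e \<in> {e \<in> edges F. e \<subseteq> C}"
    then have e: "e \<in> edges F" "e \<subseteq> insert z N" using C by auto
    then obtain a b where ab: "e = {a, b}" "a \<noteq> b" using simple_graph_edgeE[OF F] by metis
    have "a = z \<or> b = z"
    proof (rule ccontr)
      assume "\<not> ?thesis"
      then have "{z, a} \<in> edges F" "b \<noteq> z" using e ab by (auto simp: N_def)
      then show False using only_z[of a b] e ab by simp
    qed
    then show "e \<in> {{z, v} |v. v \<in> C - {z}}" using ab e C by auto
  next
    fix e assume "e \<in> {{z, v} |v. v \<in> C - {z}}"
    then show "e \<in> {e \<in> edges F. e \<subseteq> C}" using C by (auto simp: N_def)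
  qed
  then have "star (component F z)"
    unfolding star_def comp using C by auto
  then show False using nsc z by (simp add: no_star_component_def)
qed

text \<open>Part 0 is the single vertex 0, and part j > 0 is the interval of length q starting at j * q,
  whose first p elements form the neighbourhood of 0. The relation extremal_adj lists each edge
  between 0 and another vertex in one orientation only.\<close>

definition extremal_part :: "nat \<Rightarrow> nat \<Rightarrow> nat set" where
  "extremal_part q i = {u. u div q = i \<and> (i = 0 \<longrightarrow> u = 0)}"

definition extremal_adj :: "nat \<Rightarrow> nat \<Rightarrow> nat \<Rightarrow> nat \<Rightarrow> bool" where
  "extremal_adj p q u w \<longleftrightarrow> w \<noteq> 0 \<and> (u = 0 \<and> w mod q < p \<or>
     u \<noteq> 0 \<and> u div q \<noteq> w div q \<and> p \<le> u mod q \<and> p \<le> w mod q)"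

definition extremal_graph :: "nat \<Rightarrow> nat \<Rightarrow> nat \<Rightarrow> nat graph" where
  "extremal_graph m p q = ((\<Union>i<m. extremal_part q i),
     {{u, w} |u w. u \<in> (\<Union>i<m. extremal_part q i) \<and> w \<in> (\<Union>i<m. extremal_part q i) \<and>
       extremal_adj p q u w})"

lemma extremal_part_eq_image:
  assumes "q > 0" "j > 0"
  shows "extremal_part q j = (\<lambda>c. j * q + c) ` {..<q}"
proof (intro equalityI subsetI)
  fix u assume "u \<in> extremal_part q j"
  then have "u = j * q + u mod q" using assms
    by (metis (mono_tags, lifting) div_mult_mod_eq extremal_part_def mem_Collect_eq)
  then show "u \<in> (\<lambda>c. j * q + c) ` {..<q}" using assms by (metis imageI lessThan_iff mod_less_divisor)
qed (use assms in \<open>auto simp: extremal_part_def\<close>)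

lemma extremal_part_zero: "extremal_part q 0 = {0}"
  by (auto simp: extremal_part_def)

lemma card_extremal_part: "q > 0 \<Longrightarrow> j > 0 \<Longrightarrow> card (extremal_part q j) = q"
  by (simp add: extremal_part_eq_image card_image inj_on_def)

lemma finite_extremal_part: "q > 0 \<Longrightarrow> finite (extremal_part q j)"
  by (cases "j = 0") (simp_all add: extremal_part_zero extremal_part_eq_image)

text \<open>Such a part is a full period, containing each residue modulo \<open>q\<close>
  once.\<close>

lemma sum_extremal_part:
  assumes "q > 0" "j > 0"
  shows "(\<Sum>b\<in>extremal_part q j. h (b mod q)) = (\<Sum>c<q. h c)"
  unfolding extremal_part_eq_image[OF assms]
  by (subst sum.reindex) (auto simp: inj_on_def intro!: sum.cong)

lemma extremal_multipartite:
  assumes "q > 0"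
  shows "multipartite m (extremal_part q) (extremal_graph m p q)"
proof -
  have part_div: "u div q = i" if "u \<in> extremal_part q i" for u i
    using that by (simp add: extremal_part_def)
  have no_loop: "\<not> extremal_adj p q u u" for u by (auto simp: extremal_adj_def)
  have "extremal_part q i \<noteq> {}" for i
  proof -
    have "i * q \<in> extremal_part q i" using assms by (simp add: extremal_part_def)
    then show ?thesis by auto
  qed
  moreover have "simple_graph (extremal_graph m p q)"
    using assms no_loop by (auto simp: simple_graph_def extremal_graph_def finite_extremal_part) blast
  moreover have "\<not> e \<subseteq> extremal_part q i" if e: "e \<in> edges (extremal_graph m p q)" for e i
  proof
    assume sub: "e \<subseteq> extremal_part q i"
    obtain u w where uw: "e = {u, w}" "extremal_adj p q u w"
      using e by (auto simp: extremal_graph_def)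
    then have "u div q = i" "w div q = i" "i = 0 \<longrightarrow> w = 0" using sub by (auto simp: extremal_part_def)
    then show False using uw(2) by (auto simp: extremal_adj_def)
  qed
  moreover have "extremal_part q i \<inter> extremal_part q j = {}" if "i \<noteq> j" for i j
    using that part_div by blast
  ultimately show ?thesis
    by (simp add: multipartite_def extremal_graph_def)
qed

lemma extremal_edge_iff:
  assumes "q > 0" "i < j" "j < m" "a \<in> extremal_part q i" "b \<in> extremal_part q j"
  shows "{a, b} \<in> edges (extremal_graph m p q) \<longleftrightarrow>
    (if i = 0 then b mod q < p else p \<le> a mod q \<and> p \<le> b mod q)"
proof -
  have "{a, b} \<in> edges (extremal_graph m p q) \<longleftrightarrow> extremal_adj p q a b \<or> extremal_adj p q b a"
  proof -
    have "a \<in> (\<Union>i<m. extremal_part q i)" "b \<in> (\<Union>i<m. extremal_part q i)" using assms by auto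
    then show ?thesis unfolding extremal_graph_def snd_conv mem_Collect_eq doubleton_eq_iff by blast
  qed
  moreover have div: "a div q = i" "b div q = j" "i = 0 \<longrightarrow> a = 0"
    using assms by (auto simp: extremal_part_def)
  moreover have "b \<noteq> 0" using div(2) \<open>i < j\<close> by (intro notI) simp
  moreover have "a \<noteq> 0" if "i \<noteq> 0" using div(1) that by (intro notI) simp
  ultimately show ?thesis
    using assms(2) by (auto simp: extremal_adj_def)
qed

text \<open>One value increases with the proportion \<open>p / q\<close> and the other decreases.
  They balance at the root of \<open>x = (1 - x)^2\<close>, which explains the limit.\<close>

lemma extremal_edge_density:
  assumes "q > 0" "p \<le> q" "i < j" "j < m"
  shows "edge_density (extremal_graph m p q) (extremal_part q i) (extremal_part q j) =
    (if i = 0 then real p / real q else (1 - real p / real q)\<^sup>2)"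
proof -
  have disj: "extremal_part q i \<inter> extremal_part q j = {}"
    using \<open>i < j\<close> by (auto simp: extremal_part_def)
  have sums: "(\<Sum>c<q. of_bool (c < p) :: real) = real p" "(\<Sum>c<q. of_bool (p \<le> c) :: real) = real q - real p"
  proof -
    have "{..<q} \<inter> {c. c < p} = {..<p}" "{..<q} \<inter> {c. p \<le> c} = {p..<q}" using assms by auto
    then show "(\<Sum>c<q. of_bool (c < p) :: real) = real p" "(\<Sum>c<q. of_bool (p \<le> c) :: real) = real q - real p"
      using assms by (simp_all add: sum_of_bool_eq of_nat_diff)
  qed
  have dens: "edge_density (extremal_graph m p q) (extremal_part q i) (extremal_part q j) =
    (\<Sum>a\<in>extremal_part q i. \<Sum>b\<in>extremal_part q j.
      of_bool (if i = 0 then b mod q < p else p \<le> a mod q \<and> p \<le> b mod q)) /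
      (real (card (extremal_part q i)) * real (card (extremal_part q j)))"
    using assms extremal_edge_iff[of q i j m _ _ p]
    by (simp add: edge_density_eq_sum[OF _ _ disj] finite_extremal_part cong: sum.cong)
  have "j > 0" using assms by simp
  show ?thesis
  proof (cases "i = 0")
    case True
    then show ?thesis
      using dens sum_extremal_part[OF assms(1) \<open>j > 0\<close>, of "\<lambda>c. of_bool (c < p) :: real"] sums
      by (simp add: extremal_part_zero card_extremal_part[OF assms(1) \<open>j > 0\<close>])
  next
    case False
    have "(\<Sum>a\<in>extremal_part q i. \<Sum>b\<in>extremal_part q j. of_bool (p \<le> a mod q \<and> p \<le> b mod q) :: real) =
      (\<Sum>a\<in>extremal_part q i. of_bool (p \<le> a mod q)) * (\<Sum>b\<in>extremal_part q j. of_bool (p \<le> b mod q))"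
      by (simp add: sum_product of_bool_conj)
    also have "\<dots> = (real q - real p)\<^sup>2"
      using False \<open>j > 0\<close> sums sum_extremal_part[OF assms(1), of _ "\<lambda>c. of_bool (p \<le> c) :: real"]
      by (simp add: power2_eq_square)
    finally show ?thesis
      using dens False assms \<open>j > 0\<close>
      by (simp add: card_extremal_part power2_eq_square field_simps)
  qed
qed

lemma extremal_no_traversal:
  assumes F: "simple_graph F" "card (verts F) = t" "no_star_component F" and "q > 0" "r * t > 0"
  shows "\<not> has_traversal (r * t) (extremal_part q) (extremal_graph (r * t) p q) (copies r F)"
proof
  assume "has_traversal (r * t) (extremal_part q) (extremal_graph (r * t) p q) (copies r F)"
  then obtain H f where H: "traversal (r * t) (extremal_part q) (extremal_graph (r * t) p q) H"
    and f: "inj_on f (verts (copies r F))" "f ` verts (copies r F) \<subseteq> verts H"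
      "\<And>e. e \<in> edges (copies r F) \<Longrightarrow> f ` e \<in> edges H"
    unfolding has_traversal_def contains_copy_def by auto
  have sub: "finite (verts H)" "verts H \<subseteq> (\<Union>i<r * t. extremal_part q i)"
    "edges H \<subseteq> edges (extremal_graph (r * t) p q)"
    using H by (auto simp: traversal_def subgraph_def simple_graph_def extremal_graph_def)
  have one: "\<exists>!v. v \<in> verts H \<inter> extremal_part q i" if "i < r * t" for i
    using H that by (simp add: traversal_def)
  have "verts H = (\<Union>i<r * t. verts H \<inter> extremal_part q i)" using sub by auto
  then have "card (verts H) \<le> (\<Sum>i<r * t. card (verts H \<inter> extremal_part q i))"
    by (metis card_UN_le finite_lessThan)
  also have "\<dots> = (\<Sum>i<r * t. 1)"
  proof (intro sum.cong refl)
    fix i assume "i \<in> {..<r * t}"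
    then obtain v where "verts H \<inter> extremal_part q i = {v}" using one[of i] by auto
    then show "card (verts H \<inter> extremal_part q i) = 1" by simp
  qed
  finally have "card (verts H) \<le> r * t" by simp
  moreover have "card (f ` verts (copies r F)) = r * t"
    using f(1) F(2) by (simp add: card_image copies_def card_cartesian_product)
  \<comment> \<open>A traversal has as many vertices as the \<open>r\<close> copies of F together,
    so the copy fills it and in particular uses vertex 0, the only element of part 0.\<close>
  ultimately have surj: "f ` verts (copies r F) = verts H"
    using f(2) sub(1) by (intro card_seteq) auto
  have "0 \<in> verts H" using one[of 0] \<open>r * t > 0\<close>
    by (auto simp: extremal_part_zero)
  then obtain k z where kz: "k < r" "z \<in> verts F" "f (k, z) = 0"
    using surj[symmetric] by (auto simp: copies_def)
  obtain u w where uw: "{z, u} \<in> edges F" "{u, w} \<in> edges F" "w \<noteq> z"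
    using no_star_component_path2[OF F(1,3) kz(2)] by blast
  have "w \<in> verts F" using simple_graph_edgeD(2)[OF F(1) uw(2)] .
  have edge: "{f (k, a), f (k, b)} \<in> edges (extremal_graph (r * t) p q)" if "{a, b} \<in> edges F" for a b
  proof -
    have "Pair k ` {a, b} \<in> edges (copies r F)" 
      unfolding copies_def snd_conv using that kz(1) by blast
    then have "f ` Pair k ` {a, b} \<in> edges H" by (rule f(3))
    then show ?thesis using sub(3) by auto
  qed
  have "{0, f (k, u)} \<in> edges (extremal_graph (r * t) p q)" using edge[OF uw(1)] kz(3) by simp
  then have u: "f (k, u) \<noteq> 0" "f (k, u) mod q < p"
    by (auto simp: extremal_graph_def extremal_adj_def doubleton_eq_iff)
  \<comment> \<open>A nonzero vertex among the first \<open>p\<close> of its part has 0 as its only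
    neighbour, so the path of length two returns to its start, against injectivity.\<close>
  have "f (k, w) = 0"
    using edge[OF uw(2)] u by (auto simp: extremal_graph_def extremal_adj_def doubleton_eq_iff)
  then have "f (k, w) = f (k, z)" using kz by simp
  then have "(k, w) = (k, z)"
    by (rule inj_onD[OF f(1)]) (use kz \<open>w \<in> verts F\<close> in \<open>auto simp: copies_def\<close>)
  then show False using uw(3) by simp
qed

section \<open>The limiting value\<close>

lemma golden_root:
  fixes x :: real
  defines "x \<equiv> (3 - sqrt 5) / 2"
  shows "(1 - x)\<^sup>2 = x" "0 < x" "x < 1"
proof -
  have "2 < sqrt 5" "sqrt 5 < 3" by (auto intro: real_less_rsqrt real_less_lsqrt)
  then show "0 < x" "x < 1" by (auto simp: x_def)
  \<comment> \<open>Here \<open>1 - x\<close> is the reciprocal of the golden ratio.\<close>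
  have "(1 - x)\<^sup>2 = (sqrt 5 - 1)\<^sup>2 / 4" by (simp add: x_def power2_eq_square field_simps)
  also have "(sqrt 5 - 1)\<^sup>2 = 6 - 2 * sqrt (5 :: real)" by (simp add: power2_diff)
  also have "(6 - 2 * sqrt 5) / 4 = x" by (simp add: x_def field_simps)
  finally show "(1 - x)\<^sup>2 = x" .
qed

lemma ex_graph_without_traversal:
  assumes F: "simple_graph F" "card (verts F) = t" "no_star_component F" and "1 < r * t"
    and \<alpha>: "0 \<le> \<alpha>" "\<alpha> < (3 - sqrt 5) / 2"
  shows "\<exists>(P :: nat \<Rightarrow> nat set) G. multipartite (r * t) P G \<and> partite_density (r * t) P G \<ge> \<alpha> \<and>
    \<not> has_traversal (r * t) P G (copies r F)"
proof -
  \<comment> \<open>The proportion must be rational to be realised by finite parts. Any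
    \<open>y\<close> below the root keeps \<open>(1 - y)^2\<close> above the root, so both densities
    exceed \<open>\<alpha>\<close>.\<close>
  obtain y where y: "y \<in> \<rat>" "\<alpha> < y" "y < (3 - sqrt 5) / 2"
    using Rats_dense_in_real[OF \<alpha>(2)] by blast
  obtain p q where "q \<noteq> 0" and pq: "\<bar>y\<bar> = real p / real q"
    using Rats_abs_nat_div_natE[OF y(1)] by metis
  then have y_eq: "y = real p / real q" using y \<alpha> by simp
  have "q > 0" using \<open>q \<noteq> 0\<close> by simp
  have "y < 1" using y(3) golden_root(3) by (rule less_trans)
  then have "p \<le> q" using \<open>q > 0\<close> by (simp add: y_eq field_simps)
  have "(1 - (3 - sqrt 5) / 2)\<^sup>2 \<le> (1 - y)\<^sup>2"
    using y(3) golden_root(3) by (intro power_mono) auto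
  then have "\<alpha> \<le> (1 - y)\<^sup>2" using golden_root(1) \<alpha>(2) by simp
  then have "\<alpha> \<le> partite_density (r * t) (extremal_part q) (extremal_graph (r * t) p q)"
    using \<open>1 < r * t\<close> \<open>q > 0\<close> \<open>p \<le> q\<close> y(2)
    by (intro partite_density_ge) (auto simp: extremal_edge_density y_eq)
  then show ?thesis
    using extremal_multipartite[OF \<open>q > 0\<close>] extremal_no_traversal[OF F \<open>q > 0\<close>] \<open>1 < r * t\<close>
    by (metis less_trans zero_less_one)
qed

theorem theorem1p5:
  fixes F :: "'a graph" and t :: nat
  assumes "simple_graph F"
    and "card (verts F) = t" and "t \<ge> 1"
    and "bipartite F"
    and "\<not> star F"
    and "no_star_component F"
  shows "(\<lambda>r. critical_density (r * t) (copies r F)) \<longlonglongrightarrow> (3 - sqrt 5) / 2"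
proof -
  define x :: real where "x = (3 - sqrt 5) / 2"
  define A where "A r = {\<alpha> \<in> {0..1}. \<exists>(P :: nat \<Rightarrow> nat set) G.
     multipartite (r * t) P G \<and> partite_density (r * t) P G \<ge> \<alpha> \<and>
     \<not> has_traversal (r * t) P G (copies r F)}" for r
  have crit: "critical_density (r * t) (copies r F) = Sup (A r)" for r
    by (simp add: critical_density_def A_def)
  have x: "(1 - x)\<^sup>2 = x" "0 < x" "x < 1"
    using golden_root by (simp_all add: x_def)
  \<comment> \<open>This gives at least two parts for every \<open>r \<ge> 1\<close>, so that the
    partite density is a minimum over a nonempty set.\<close>
  have "t > 1"
  proof (rule ccontr)
    assume "\<not> t > 1"
    then have "card (verts F) = 1" using assms(2,3) by simp
    then obtain z where z: "verts F = {z}" by (rule card_1_singletonE)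
    obtain u where u: "{z, u} \<in> edges F"
      using no_star_component_path2[OF assms(1,6), of z] z by auto
    show False using simple_graph_edgeD(2,3)[OF assms(1) u] z by simp
  qed
  have mem: "\<alpha> \<in> A r" if "r \<ge> 1" "0 \<le> \<alpha>" "\<alpha> < x" for r \<alpha>
  proof -
    have "1 < r * t" using \<open>t > 1\<close> mult_le_mono1[OF \<open>r \<ge> 1\<close>, of t] by linarith
    moreover have "\<alpha> \<le> 1" using that x(3) by linarith
    ultimately show ?thesis
      using ex_graph_without_traversal[OF assms(1,2,6), of r \<alpha>] that
      unfolding A_def x_def by (intro CollectI conjI) auto
  qed
  have bdd: "bdd_above (A r)" for r by (rule bdd_aboveI[of _ 1]) (simp add: A_def)
  have lower: "x \<le> Sup (A r)" if "r \<ge> 1" for r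
  \<comment> \<open>The extremal graphs are available for densities strictly below \<open>x\<close>,
    so the bound at \<open>x\<close> is reached by approximation.\<close>
  proof (rule dense_le_bounded[OF x(2)])
    fix \<alpha> assume "0 < \<alpha>" "\<alpha> < x"
    then show "\<alpha> \<le> Sup (A r)" using mem[OF that] bdd by (intro cSup_upper) auto
  qed
  show ?thesis
    unfolding x_def[symmetric] crit
  proof (rule LIMSEQ_I)
    fix \<epsilon> :: real assume "\<epsilon> > 0"
    \<comment> \<open>The cap at 1 gives \<open>\<eta> * \<eta> \<le> \<eta>\<close>, by which
      \<open>x + \<eta>\<close> satisfies the strict inequality required of
      \<open>\<gamma>\<close>.\<close>
    define \<eta> where "\<eta> = min 1 (\<epsilon> / 2)"
    have \<eta>: "0 < \<eta>" "\<eta> \<le> 1" "\<eta> < \<epsilon>" using \<open>\<epsilon> > 0\<close> by (auto simp: \<eta>_def)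
    have "(1 - (x + \<eta>))\<^sup>2 = x - 2 * \<eta> * (1 - x) + \<eta> * \<eta>"
      using x(1) by (simp add: power2_eq_square algebra_simps)
    also have "\<dots> < x + \<eta>"
    proof -
      have "0 < \<eta> * (1 - x)" "\<eta> * \<eta> \<le> \<eta> * 1" using \<eta> x(3) by (simp, intro mult_left_mono) auto
      then show ?thesis by linarith
    qed
    finally obtain R where R: "\<forall>r\<ge>R. \<forall>(P :: nat \<Rightarrow> nat set) G. multipartite (r * t) P G \<longrightarrow>
      x + \<eta> \<le> partite_density (r * t) P G \<longrightarrow> has_traversal (r * t) P G (copies r F)"
      using ex_traversal_threshold[OF assms(1,2,3,4)] by blast
    have "norm (Sup (A r) - x) < \<epsilon>" if "r \<ge> max 1 R" for r
    proof -
      have "A r \<noteq> {}" using mem[of r 0] that x(2) by auto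
      moreover have "\<alpha> \<le> x + \<eta>" if "\<alpha> \<in> A r" for \<alpha>
      proof (rule ccontr)
        assume "\<not> \<alpha> \<le> x + \<eta>"
        obtain P :: "nat \<Rightarrow> nat set" and G where "multipartite (r * t) P G"
          "partite_density (r * t) P G \<ge> \<alpha>" "\<not> has_traversal (r * t) P G (copies r F)"
          using \<open>\<alpha> \<in> A r\<close> by (auto simp: A_def)
        then show False using R \<open>r \<ge> max 1 R\<close> \<open>\<not> \<alpha> \<le> x + \<eta>\<close> by fastforce
      qed
      ultimately have "Sup (A r) \<le> x + \<eta>" by (rule cSup_least)
      then show ?thesis using lower[of r] that \<eta> by simp
    qed
    then show "\<exists>N. \<forall>r\<ge>N. norm (Sup (A r) - x) < \<epsilon>" by blast
  qed
qed

end
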